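(* Let $m,n$ be positive integers with $m>n$. Then the metric space $\mathcal{RIF}(m,n)$ of $m\times n$ matrix-valued rational inner functions in the unit disk, equipped with the metric induced by the supremum norm $\|\cdot\|_\infty$, is path connected.
   Context: An $m\times n$ matrix-valued rational function is an $m\times n$ matrix $W(z)$ each of whose entries $w_{ij}(z)$ is a rational function (with complex coefficients) of the complex variable $z$. Let $\|W\|_\infty=\sup_{|z|<1}\|W(z)\|$, where $\|W(z)\|$ is the operator norm of $W(z)$ as a linear map from $\mathbb{C}^n$ to $\mathbb{C}^m$ with their Euclidean norms. For rational $W$, $\|W\|_\infty<\infty$ if and only if $W$ has no poles in $|z|\le 1$, and in that case $W$ extends continuously to the closed disk $|z|\le 1$; only such functions are considered. An $m\times n$ rational matrix function $W$ is called inner if $\|W\|_\infty\le 1$ and $W(e^{i\theta})^*W(e^{i\theta})=I_n$ for all $\theta\in[0,2\pi]$, where $^*$ denotes the conjugate transpose and $I_n$ the $n\times n$ identity matrix. $\mathcal{RIF}(m,n)$ denotes the set of all $m\times n$ matrix rational inner functions, with the metric $d(W_1,W_2)=\|W_1-W_2\|_\infty$; its topology is that of uniform convergence on the closed disk $|z|\le 1$. *)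

theory Defs
  imports "HOL-Analysis.Analysis" "HOL-Computational_Algebra.Computational_Algebra"
begin

text \<open>
  A rational function is represented by the total function that is given by its reduced fraction.
  At a pole the denominator vanishes, so the value there is \<open>0\<close> because \<open>x / 0 = 0\<close>. This makes the
  representing function unique, and it has no removable singularities.
\<close>

definition rational_function :: "(complex \<Rightarrow> complex) \<Rightarrow> bool" where
  "rational_function f \<longleftrightarrow>
     (\<exists>p q. q \<noteq> 0 \<and> coprime p q \<and> (\<forall>z. f z = poly p z / poly q z))"

definition rational_matrix_function :: "(complex \<Rightarrow> complex^'n^'m) \<Rightarrow> bool" where
  "rational_matrix_function W \<longleftrightarrow> (\<forall>i j. rational_function (\<lambda>z. W z $ i $ j))"

text \<open>
  The supremum norm is extended-valued. The value \<open>0\<close> at the (isolated) poles does not affect it: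
  if a pole lies in the closed unit disk, the values at nearby points of the open disk make the
  supremum infinite.
\<close>

definition sup_norm :: "(complex \<Rightarrow> complex^'n^'m) \<Rightarrow> ennreal" where
  "sup_norm W = (SUP z\<in>ball 0 1. ennreal (onorm (\<lambda>x. W z *v x)))"

definition conj_transpose :: "complex^'n^'m \<Rightarrow> complex^'m^'n" where
  "conj_transpose A = (\<chi> i j. cnj (A $ j $ i))"

definition rational_inner :: "(complex \<Rightarrow> complex^'n^'m) \<Rightarrow> bool" where
  "rational_inner W \<longleftrightarrow>
     rational_matrix_function W \<and> sup_norm W \<le> 1 \<and>
     (\<forall>\<theta>\<in>{0..2*pi}. conj_transpose (W (cis \<theta>)) ** W (cis \<theta>) = mat 1)"

definition RIF :: "(complex \<Rightarrow> complex^'n^'m) set" where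
  "RIF = {W. rational_inner W}"

definition RIF_dist :: "(complex \<Rightarrow> complex^'n^'m) \<Rightarrow> (complex \<Rightarrow> complex^'n^'m) \<Rightarrow> real" where
  "RIF_dist V W = enn2real (sup_norm (\<lambda>z. V z - W z))"

lemma rational_function_eqI:
  assumes f: "rational_function f" and g: "rational_function g"
    and eq: "\<And>z. z \<in> ball 0 1 \<Longrightarrow> f z = g z"
  shows "f = g"
proof
  fix z
  obtain p q where pq: "q \<noteq> 0" "coprime p q" "\<And>z. f z = poly p z / poly q z"
    using f unfolding rational_function_def by blast
  obtain r s where rs: "s \<noteq> 0" "coprime r s" "\<And>z. g z = poly r z / poly s z"
    using g unfolding rational_function_def by blast
  have no_common: "poly a w \<noteq> 0" if "coprime a b" "poly b w = 0" for a b :: "complex poly" and w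
    using that by (metis coprime_poly_0)
  have "p * s - r * q = 0"
  proof (rule ccontr)
    assume nz: "p * s - r * q \<noteq> 0"
    have "ball (0::complex) 1 \<subseteq> {w. poly ((p * s - r * q) * (q * s)) w = 0}"
    proof
      fix w :: complex assume "w \<in> ball 0 1"
      then have "poly p w / poly q w = poly r w / poly s w"
        using eq[of w] pq(3)[of w] rs(3)[of w] by metis
      then show "w \<in> {w. poly ((p * s - r * q) * (q * s)) w = 0}"
        by (cases "poly q w = 0 \<or> poly s w = 0") (auto simp: frac_eq_eq)
    qed
    moreover have "finite {w. poly ((p * s - r * q) * (q * s)) w = 0}"
      using nz pq(1) rs(1) by (intro poly_roots_finite) auto
    ultimately have "finite (ball (0::complex) 1)"
      by (rule finite_subset)
    then show False
      using uncountable_ball[of 1 "0::complex"] countable_finite by auto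
  qed
  then have cross: "poly p z * poly s z = poly r z * poly q z"
    by (metis eq_iff_diff_eq_0 poly_mult)
  show "f z = g z"
  proof (cases "poly q z = 0 \<or> poly s z = 0")
    case True
    then have "poly q z = 0" "poly s z = 0"
      using cross no_common[OF pq(2)] no_common[OF rs(2)] by auto
    then show ?thesis using pq(3) rs(3) by simp
  next
    case False
    then show ?thesis using cross pq(3) rs(3) by (simp add: frac_eq_eq)
  qed
qed

lemma sup_norm_triangle:
  "sup_norm (\<lambda>z. A z + B z) \<le> sup_norm A + sup_norm (B :: complex \<Rightarrow> complex^'n^'m)"
  unfolding sup_norm_def
proof (rule SUP_least)
  fix z :: complex assume z: "z \<in> ball 0 1"
  have "onorm (\<lambda>x. (A z + B z) *v x) \<le> onorm (\<lambda>x. A z *v x) + onorm (\<lambda>x. B z *v x)"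
    unfolding matrix_vector_mult_add_rdistrib by (intro onorm_triangle) auto
  then have "ennreal (onorm (\<lambda>x. (A z + B z) *v x))
      \<le> ennreal (onorm (\<lambda>x. A z *v x)) + ennreal (onorm (\<lambda>x. B z *v x))"
    by (simp add: onorm_pos_le flip: ennreal_plus)
  also have "\<dots> \<le> (SUP z\<in>ball 0 1. ennreal (onorm (\<lambda>x. A z *v x)))
      + (SUP z\<in>ball 0 1. ennreal (onorm (\<lambda>x. B z *v x)))"
    using z by (intro add_mono SUP_upper)
  finally show "ennreal (onorm (\<lambda>x. (A z + B z) *v x)) \<le> \<dots>" .
qed

lemma sup_norm_minus_commute:
  "sup_norm (\<lambda>z. V z - W z) = sup_norm (\<lambda>z. W z - (V z :: complex^'n^'m))"
proof -
  have "onorm (\<lambda>x. (V z - W z) *v x) = onorm (\<lambda>x. (W z - V z) *v x)" for z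
    using onorm_neg[of "\<lambda>x. (V z - W z) *v x"]
    by (simp add: matrix_vector_mult_diff_rdistrib)
  then show ?thesis by (simp add: sup_norm_def)
qed

lemma sup_norm_minus: "sup_norm (\<lambda>z. - W z) = sup_norm (W :: complex \<Rightarrow> complex^'n^'m)"
  using sup_norm_minus_commute[of "\<lambda>_. 0" W] by simp

lemma sup_norm_eq_0:
  assumes "sup_norm W = 0" "z \<in> ball 0 1"
  shows "W z = (0 :: complex^'n^'m)"
proof -
  have "ennreal (onorm (\<lambda>x. W z *v x)) \<le> 0"
    using assms unfolding sup_norm_def by (metis SUP_upper)
  then have "onorm (\<lambda>x. W z *v x) = 0"
    by (simp add: ennreal_eq_0_iff antisym onorm_pos_le)
  then have "\<forall>x. W z *v x = 0" by (subst (asm) onorm_eq_0) auto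
  then show ?thesis by (simp add: matrix_eq)
qed

lemma Metric_space_RIF:
  "Metric_space (RIF :: (complex \<Rightarrow> complex^'n^'m) set) RIF_dist"
proof
  fix U V W :: "complex \<Rightarrow> complex^'n^'m"
  show "0 \<le> RIF_dist V W" by (simp add: RIF_dist_def)
  show "RIF_dist V W = RIF_dist W V"
    unfolding RIF_dist_def by (subst sup_norm_minus_commute) simp
  have fin: "sup_norm (\<lambda>z. A z - B z) < top" if "A \<in> RIF" "B \<in> RIF"
    for A B :: "complex \<Rightarrow> complex^'n^'m"
  proof -
    have "sup_norm (\<lambda>z. A z - B z) \<le> sup_norm A + sup_norm (\<lambda>z. - B z)"
      using sup_norm_triangle[of A "\<lambda>z. - B z"] by simp
    also have "\<dots> \<le> 1 + 1"
      using that by (intro add_mono) (auto simp: sup_norm_minus RIF_def rational_inner_def)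
    also have "\<dots> < top" by simp
    finally show ?thesis .
  qed
  show "RIF_dist V W = 0 \<longleftrightarrow> V = W" if VW: "V \<in> RIF" "W \<in> RIF"
  proof
    assume "RIF_dist V W = 0"
    then have "sup_norm (\<lambda>z. V z - W z) = 0"
      using fin[OF VW] by (auto simp: RIF_dist_def enn2real_eq_0_iff)
    then have eq: "V z = W z" if "z \<in> ball 0 1" for z
      using sup_norm_eq_0[of "\<lambda>z. V z - W z" z] that by simp
    have "(\<lambda>z. V z $ i $ j) = (\<lambda>z. W z $ i $ j)" for i j
      using VW eq
      by (intro rational_function_eqI)
        (auto simp: RIF_def rational_inner_def rational_matrix_function_def)
    then show "V = W" by (simp add: fun_eq_iff vec_eq_iff)
  next
    assume "V = W"
    moreover have "sup_norm (\<lambda>z. 0 :: complex^'n^'m) = 0"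
      by (simp add: sup_norm_def onorm_zero)
    ultimately show "RIF_dist V W = 0" by (simp add: RIF_dist_def)
  qed
  show "RIF_dist U W \<le> RIF_dist U V + RIF_dist V W"
    if "U \<in> RIF" "V \<in> RIF" "W \<in> RIF"
  proof -
    have "sup_norm (\<lambda>z. U z - W z) \<le> sup_norm (\<lambda>z. U z - V z) + sup_norm (\<lambda>z. V z - W z)"
      using sup_norm_triangle[of "\<lambda>z. U z - V z" "\<lambda>z. V z - W z"] by simp
    then have "enn2real (sup_norm (\<lambda>z. U z - W z))
        \<le> enn2real (sup_norm (\<lambda>z. U z - V z) + sup_norm (\<lambda>z. V z - W z))"
      using fin that by (intro enn2real_mono) auto
    then show ?thesis
      using fin that by (simp add: RIF_dist_def enn2real_plus)
  qed
qed

end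

theory Submission
  imports Defs "HOL-Complex_Analysis.Complex_Analysis" "HOL-Computational_Algebra.Field_as_Ring"
begin

text \<open>
  Call a matrix function on the closed disk inner if it is rational without poles there and isometric
  on the circle. Let \<open>B\<close> be a Blaschke-Potapov factor: it multiplies the direction of a unit vector
  \<open>v\<close> by \<open>b z = (z - a) / (1 - cnj a * z)\<close> and fixes the orthogonal complement of \<open>v\<close>. Two facts
  prove the theorem.

  Every inner \<open>F\<close> is a product \<open>B\<^sub>1 \<dots> B\<^sub>k V\<close> of such factors with a constant isometry \<open>V\<close>
  (\<open>split_off_blaschke_factor\<close>, \<open>cancel_common_factor\<close>). Write \<open>F = P / q\<close> with all degrees at most
  \<open>N\<close>, and let \<open>p\<^sup>*(z) = z\<^sup>N cnj (p (1 / cnj z))\<close>. That \<open>F\<close> is isometric on the circle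
  is the polynomial identity \<open>\<Sum>i. P\<^sup>*\<^sub>i\<^sub>j P\<^sub>i\<^sub>k = \<delta>\<^sub>j\<^sub>k q\<^sup>* q\<close>. As \<open>q 0 \<noteq> 0\<close>, the polynomial \<open>q\<^sup>*\<close> has degree
  \<open>N\<close>; if \<open>N > 0\<close>, it has a root \<open>a\<close>, and \<open>a\<close> lies in the open disk because \<open>q\<close> has no zero in the
  closed one. Let \<open>L\<close> be the conjugate of \<open>P\<^sup>*(a)\<close>, which, if it is nonzero, is up to a scalar the
  leading coefficient of \<open>F\<close> at the pole \<open>1 / cnj a\<close> (possibly at infinity). The identity says that the columns of \<open>L\<close> are
  orthogonal to those of \<open>P(a)\<close>. If \<open>v\<close> is a normalised nonzero column of \<open>L\<close>, the factor with data
  \<open>a\<close>, \<open>v\<close> can therefore be divided out of \<open>F\<close> without new poles. Division keeps \<open>q\<close> and replaces \<open>L\<close> by its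
  projection to the complement of \<open>v\<close>, so one more column of \<open>L\<close> vanishes. When all columns vanish, \<open>P\<close>
  and \<open>q\<close> share the factor \<open>1 - cnj a * z\<close>, and \<open>N\<close> drops.

  Because there are more rows than columns, some unit vector \<open>w\<close> is orthogonal to the range of
  \<open>V\<close>. Moving \<open>v\<close> to \<open>w\<close> along the unit sphere deforms \<open>B V\<close>, through inner functions, to \<open>V\<close>
  (\<open>inner_homotopic_remove_twist\<close>). The factors are thus removed one by one, starting with the innermost,
  and what remains is a constant isometry. Constant isometries are connected to one another by
  complex Householder reflections, one column at a time (\<open>isometric_constants_homotopic\<close>).

  Deformations are homotopies of maps on the closed disk through inner functions. By compactness
  they are uniformly continuous, so they are paths for the supremum norm
  (\<open>inner_homotopic_path_component\<close>). The maximum principle shows that the inner functions above are,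
  on the closed disk, the restrictions of the elements of the metric space (\<open>RIF_inner_fraction\<close>,
  \<open>disc_inner_RIF\<close>).
\<close>

section \<open>Isometric matrices and rank-one twists\<close>

definition cinner :: "complex^'a \<Rightarrow> complex^'a \<Rightarrow> complex" where
  "cinner u v = (\<Sum>k\<in>UNIV. cnj (u $ k) * v $ k)"

lemma cinner_add_left: "cinner (u + v) w = cinner u w + cinner v w"
  and cinner_add_right: "cinner w (u + v) = cinner w u + cinner w v"
  and cinner_diff_left: "cinner (u - v) w = cinner u w - cinner v w"
  and cinner_diff_right: "cinner w (u - v) = cinner w u - cinner w v"
  and cinner_scale_left: "cinner (c *s u) w = cnj c * cinner u w"
  and cinner_scale_right: "cinner w (c *s u) = c * cinner w u"
  by (simp_all add: cinner_def algebra_simps sum.distrib sum_subtractf sum_distrib_left)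

lemma cinner_commute: "cinner u v = cnj (cinner v u)"
  by (simp add: cinner_def mult.commute)

lemma cinner_self: "cinner v v = of_real ((norm v)\<^sup>2)"
proof -
  have "(norm v)\<^sup>2 = (\<Sum>k\<in>UNIV. (norm (v $ k))\<^sup>2)"
    by (simp add: norm_vec_def L2_set_def sum_nonneg)
  then show ?thesis
    by (simp add: cinner_def mult.commute[of "cnj _"] complex_norm_square flip: of_real_power)
qed

lemma norm_cinner_le: "norm (cinner u v) \<le> norm u * norm v"
proof -
  have "norm (cinner u v) \<le> (\<Sum>k\<in>UNIV. \<bar>norm (u $ k)\<bar> * \<bar>norm (v $ k)\<bar>)"
    unfolding cinner_def by (rule order_trans[OF norm_sum]) (simp add: norm_mult)
  also have "\<dots> \<le> norm u * norm v"
    unfolding norm_vec_def by (rule L2_set_mult_ineq)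
  finally show ?thesis .
qed

lemma cinner_axis: "cinner (axis i 1) v = v $ i"
proof -
  have "cinner (axis i 1) v = (\<Sum>k\<in>UNIV. if k = i then v $ k else 0)"
    unfolding cinner_def by (intro sum.cong) (auto simp: axis_def)
  then show ?thesis by simp
qed

lemma continuous_on_cinner [continuous_intros]:
  assumes "continuous_on S f" "continuous_on S g"
  shows "continuous_on S (\<lambda>x. cinner (f x) (g x))"
  unfolding cinner_def by (intro continuous_intros assms)

definition isometric :: "complex^'n^'m \<Rightarrow> bool" where
  "isometric A \<longleftrightarrow> (\<forall>j k. cinner (column j A) (column k A) = (if j = k then 1 else 0))"

lemma isometric_iff: "isometric A \<longleftrightarrow> conj_transpose A ** A = mat 1"
  by (simp add: isometric_def cinner_def conj_transpose_def matrix_matrix_mult_def mat_def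
      column_def vec_eq_iff)

lemma norm_isometric: "isometric A \<Longrightarrow> norm (A *v x) = norm x"
proof -
  assume A: "isometric A"
  have "cinner (A *v x) (A *v x) = cinner x ((conj_transpose A ** A) *v x)"
  proof -
    have "cinner (A *v x) (A *v x)
        = (\<Sum>i\<in>UNIV. \<Sum>j\<in>UNIV. cnj (A $ i $ j) * cnj (x $ j) * (\<Sum>k\<in>UNIV. A $ i $ k * x $ k))"
      by (simp add: cinner_def matrix_vector_mult_def sum_distrib_right)
    also have "\<dots> = (\<Sum>j\<in>UNIV. \<Sum>i\<in>UNIV. cnj (A $ i $ j) * cnj (x $ j) * (\<Sum>k\<in>UNIV. A $ i $ k * x $ k))"
      by (rule sum.swap)
    also have "\<dots> = cinner x (conj_transpose A *v (A *v x))"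
      by (simp add: cinner_def matrix_vector_mult_def conj_transpose_def sum_distrib_left mult_ac)
    finally show ?thesis by (simp add: matrix_vector_mul_assoc)
  qed
  then have "(norm (A *v x))\<^sup>2 = (norm x)\<^sup>2"
    using A by (simp add: isometric_iff cinner_self flip: of_real_power)
  then show ?thesis by simp
qed

text \<open>
  For a unit vector \<open>v\<close> this is the product of \<open>I - v v\<^sup>* + c v v\<^sup>*\<close> and \<open>A\<close>: the component along \<open>v\<close> is
  scaled by \<open>c\<close>. A Blaschke factor for \<open>c\<close> gives a Blaschke-Potapov factor, a constant of modulus one a
  complex reflection, and \<open>c = 0\<close> the projection to the complement of \<open>v\<close>.
\<close>

definition twist :: "complex \<Rightarrow> complex^'m \<Rightarrow> complex^'n^'m \<Rightarrow> complex^'n^'m" where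
  "twist c v A = (\<chi> i j. A $ i $ j + (c - 1) * v $ i * cinner v (column j A))"

lemma column_twist:
  "column j (twist c v A) = column j A + ((c - 1) * cinner v (column j A)) *s v"
  by (simp add: twist_def column_def vec_eq_iff)

lemma isometric_twist:
  assumes "norm c = 1" "norm v = 1" "isometric A"
  shows "isometric (twist c v A)"
  unfolding isometric_def
proof (intro allI)
  fix j k
  let ?x = "column j A" and ?y = "column k A"
  have v: "cinner v v = 1" using assms(2) by (simp add: cinner_self)
  have c: "cnj c * c = 1"
    using assms(1) complex_norm_square[of c] by (simp add: mult.commute)
  have "cinner (column j (twist c v A)) (column k (twist c v A))
      = cinner ?x ?y + (cnj c * c - 1) * (cinner ?x v * cinner v ?y)"
    by (simp add: column_twist cinner_add_left cinner_add_right cinner_scale_left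
        cinner_scale_right cinner_diff_left cinner_diff_right v cinner_commute[of v ?x] algebra_simps)
  then show "cinner (column j (twist c v A)) (column k (twist c v A)) = (if j = k then 1 else 0)"
    using assms(3) c by (simp add: isometric_def)
qed

lemma twist_1 [simp]: "twist 1 v A = A"
  by (simp add: twist_def vec_eq_iff)

lemma twist_twist:
  assumes "norm v = 1"
  shows "twist c v (twist d v A) = twist (c * d) v A"
proof -
  have v: "cinner v v = 1" using assms by (simp add: cinner_self)
  show ?thesis
    unfolding twist_def[of c] twist_def[of "c * d"] column_twist
    by (simp add: vec_eq_iff twist_def cinner_add_right cinner_diff_right cinner_scale_right v algebra_simps)
qed

lemma continuous_on_twist [continuous_intros]:
  assumes "continuous_on S c" "continuous_on S v" "continuous_on S A"
  shows "continuous_on S (\<lambda>x. twist (c x) (v x) (A x))"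
  unfolding twist_def column_def by (intro continuous_intros assms)

text \<open>
  The reflection along \<open>x - y\<close> with a phase. A real reflection (phase \<open>-1\<close>) only works if \<open>cinner y x\<close> is
  real; otherwise the phase \<open>- (1 - cnj s) / (1 - s)\<close> with \<open>s = cinner y x\<close> compensates, since
  \<open>\<bar>x - y\<bar>\<^sup>2 = (1 - s) + (1 - cnj s)\<close>. The axis is a multiple of \<open>x - y\<close>, so everything orthogonal to both
  vectors stays fixed.
\<close>

lemma householder_reflection:
  fixes x y :: "complex^'m"
  assumes x: "norm x = 1" and y: "norm y = 1" and ne: "x \<noteq> y"
  obtains t r where "norm (r *s (x - y)) = 1"
    "x + ((cis t - 1) * cinner (r *s (x - y)) x) *s (r *s (x - y)) = y"
proof -
  define s where "s = cinner y x"
  define d where "d = norm (x - y)"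
  have d: "d > 0" using ne by (simp add: d_def)
  have dd: "of_real (d^2) = 2 - s - cnj s"
  proof -
    have "cinner x x = 1" "cinner y y = 1" using x y by (simp_all add: cinner_self)
    then have "cinner (x - y) (x - y) = 2 - s - cnj s"
      unfolding cinner_diff_left cinner_diff_right cinner_commute[of x y] by (simp add: s_def)
    then show ?thesis by (simp add: cinner_self d_def)
  qed
  have s1: "s \<noteq> 1"
    using dd d by auto
  define c where "c = - ((1 - cnj s) / (1 - s))"
  have "norm c = 1"
  proof -
    have "norm (1 - cnj s) = norm (1 - s)" by (metis complex_cnj_diff complex_cnj_one complex_mod_cnj)
    then show ?thesis using s1 by (simp add: c_def norm_divide)
  qed
  then obtain t where t: "c = cis t"
    by (metis complex_unit_circle complex_norm cis_Arg norm_eq_zero sgn_eq div_by_1 of_real_1 zero_neq_one)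
  define r where "r = complex_of_real (1 / d)"
  have n: "norm (r *s (x - y)) = 1"
  proof -
    have "cinner (r *s w) (r *s w) = 1" if "norm w = d" for w :: "complex^'m"
      unfolding cinner_scale_left cinner_scale_right unfolding cinner_self that r_def
      using d by (simp add: power2_eq_square)
    from this[of "x - y"] have "(norm (r *s (x - y)))\<^sup>2 = 1\<^sup>2"
      unfolding cinner_self d_def by (simp flip: of_real_power)
    then show ?thesis by (rule power2_eq_imp_eq) auto
  qed
  have cs: "(c - 1) * (1 - s) = - of_real (d^2)"
    unfolding dd c_def using s1 by (simp add: field_simps)
  have "cinner (x - y) x = 1 - s"
    using x by (simp add: cinner_diff_left cinner_self s_def)
  then have e: "cinner (r *s (x - y)) x = r * (1 - s)"
    unfolding cinner_scale_left by (simp add: r_def)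
  have "(c - 1) * cinner (r *s (x - y)) x * r = ((c - 1) * (1 - s)) * (r * r)"
    unfolding e by (simp only: mult_ac)
  also have "\<dots> = -1"
    unfolding cs r_def using d by (simp add: power2_eq_square)
  finally have "(c - 1) * cinner (r *s (x - y)) x * r = -1" .
  then have "((c - 1) * cinner (r *s (x - y)) x) *s (r *s (x - y)) = - (x - y)"
    by (metis vector_smult_assoc vector_sneg_minus1)
  then show ?thesis using that[of r t] n t by simp
qed

section \<open>Inner functions on the closed disk and their homotopies\<close>

definition scalar_inner :: "(complex \<Rightarrow> complex) \<Rightarrow> bool" where
  "scalar_inner b \<longleftrightarrow>
     (\<exists>p q. \<forall>z\<in>cball 0 1. poly q z \<noteq> 0 \<and> b z = poly p z / poly q z) \<and>
     (\<forall>z\<in>sphere 0 1. norm (b z) = 1)"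

text \<open>
  This depends only on the values on the closed disk, so pointwise products need no adjustment at
  removable singularities outside of it.
\<close>

definition disc_inner :: "(complex \<Rightarrow> complex^'n^'m) \<Rightarrow> bool" where
  "disc_inner F \<longleftrightarrow>
     (\<exists>P q. \<forall>z\<in>cball 0 1. poly q z \<noteq> 0 \<and> (\<forall>i j. F z $ i $ j = poly (P i j) z / poly q z)) \<and>
     (\<forall>z\<in>sphere 0 1. isometric (F z))"

abbreviation inner_homotopic ::
    "(complex \<Rightarrow> complex^'n^'m) \<Rightarrow> (complex \<Rightarrow> complex^'n^'m) \<Rightarrow> bool" where
  "inner_homotopic F G \<equiv> homotopic_with_canon disc_inner (cball 0 1) UNIV F G"

lemma disc_inner_cong:
  assumes "\<And>z. z \<in> cball 0 1 \<Longrightarrow> F z = G z"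
  shows "disc_inner F \<longleftrightarrow> disc_inner G"
proof -
  have "z \<in> sphere 0 1 \<Longrightarrow> F z = G z" for z using assms[of z] by auto
  then show ?thesis using assms by (simp add: disc_inner_def)
qed

lemma continuous_on_scalar_inner:
  assumes "scalar_inner b" shows "continuous_on (cball 0 1) b"
proof -
  obtain p q where "\<forall>z\<in>cball 0 1. poly q z \<noteq> 0 \<and> b z = poly p z / poly q z"
    using assms by (auto simp: scalar_inner_def)
  then show ?thesis
    by (subst continuous_on_cong[where g = "\<lambda>z. poly p z / poly q z"]) (auto intro!: continuous_intros)
qed

lemma continuous_on_disc_inner:
  assumes "disc_inner F" shows "continuous_on (cball 0 1) F"
proof -
  obtain P q where PQ: "\<forall>z\<in>cball 0 1. poly q z \<noteq> 0 \<and> (\<forall>i j. F z $ i $ j = poly (P i j) z / poly q z)"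
    using assms by (auto simp: disc_inner_def)
  have "continuous_on (cball 0 1) (\<lambda>z. \<chi> i j. poly (P i j) z / poly q z)"
    using PQ by (intro continuous_intros) auto
  then show ?thesis
    using PQ by (subst continuous_on_cong[where g = "\<lambda>z. \<chi> i j. poly (P i j) z / poly q z"])
      (auto simp: vec_eq_iff)
qed

lemma one_minus_cnj_mult_nonzero:
  assumes "norm a < 1" "norm z \<le> 1" shows "1 - cnj a * z \<noteq> 0"
proof
  assume "1 - cnj a * z = 0"
  then have "cnj a * z = 1" by simp
  then have "norm (cnj a * z) = 1" by simp
  moreover have "norm (cnj a * z) < 1"
    using assms by (simp add: norm_mult) (smt (verit, best) mult_left_le norm_ge_zero)
  ultimately show False by simp
qed

lemma scalar_inner_blaschke:
  assumes a: "norm a < 1"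
  shows "scalar_inner (\<lambda>z. (z - a) / (1 - cnj a * z))"
  unfolding scalar_inner_def
proof
  show "\<exists>p q. \<forall>z\<in>cball 0 1. poly q z \<noteq> 0 \<and> (z - a) / (1 - cnj a * z) = poly p z / poly q z"
    using one_minus_cnj_mult_nonzero[OF a]
    by (intro exI[of _ "[:- a, 1:]"] exI[of _ "[:1, - cnj a:]"]) (auto simp: algebra_simps)
  show "\<forall>z\<in>sphere 0 1. norm ((z - a) / (1 - cnj a * z)) = 1"
  proof
    fix z :: complex assume z: "z \<in> sphere 0 1"
    then have "z * cnj z = 1" by (simp flip: complex_norm_square)
    then have "1 - cnj a * z = z * cnj (z - a)" by (simp add: algebra_simps)
    then have "norm (1 - cnj a * z) = norm (z - a)"
      using z by (simp only: norm_mult complex_mod_cnj) simp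
    moreover have "norm (1 - cnj a * z) \<noteq> 0"
      using one_minus_cnj_mult_nonzero[OF a, of z] z by simp
    ultimately show "norm ((z - a) / (1 - cnj a * z)) = 1"
      unfolding norm_divide by (metis divide_self)
  qed
qed

lemma disc_inner_twist:
  assumes "disc_inner F" "scalar_inner b" "norm v = 1"
  shows "disc_inner (\<lambda>z. twist (b z) v (F z))"
proof -
  obtain P q where PQ: "\<And>z. z \<in> cball 0 1 \<Longrightarrow> poly q z \<noteq> 0"
      "\<And>z i j. z \<in> cball 0 1 \<Longrightarrow> F z $ i $ j = poly (P i j) z / poly q z"
    using assms(1) unfolding disc_inner_def by blast
  obtain r s where rs: "\<And>z. z \<in> cball 0 1 \<Longrightarrow> poly s z \<noteq> 0"
      "\<And>z. z \<in> cball 0 1 \<Longrightarrow> b z = poly r z / poly s z"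
    using assms(2) unfolding scalar_inner_def by blast
  define P' where "P' = (\<lambda>i j. s * P i j
    + smult (v $ i) ((r - s) * (\<Sum>k\<in>UNIV. smult (cnj (v $ k)) (P k j))))"
  have "twist (b z) v (F z) $ i $ j = poly (P' i j) z / poly (s * q) z" if z: "z \<in> cball 0 1" for z i j
  proof -
    define S where "S = (\<Sum>k\<in>UNIV. cnj (v $ k) * poly (P k j) z)"
    have cin: "cinner v (column j (F z)) = S / poly q z"
      using PQ z by (simp add: cinner_def column_def S_def sum_divide_distrib)
    have "poly (P' i j) z = poly s z * poly (P i j) z + v $ i * ((poly r z - poly s z) * S)"
      by (simp add: P'_def poly_sum S_def)
    moreover have "twist (b z) v (F z) $ i $ j
        = poly (P i j) z / poly q z + (poly r z / poly s z - 1) * v $ i * (S / poly q z)"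
      by (simp add: twist_def cin PQ(2)[OF z] rs(2)[OF z])
    moreover have "x / q' + (r' / s' - 1) * w * (S / q') = (s' * x + w * ((r' - s') * S)) / (s' * q')"
      if "q' \<noteq> 0" "s' \<noteq> 0" for x q' r' s' w :: complex
      using that by (simp add: field_simps)
    ultimately show ?thesis
      using PQ(1)[OF z] rs(1)[OF z] by simp
  qed
  moreover have "poly (s * q) z \<noteq> 0" if "z \<in> cball 0 1" for z
    using PQ(1) rs(1) that by simp
  moreover have "isometric (twist (b z) v (F z))" if "z \<in> sphere 0 1" for z
    using assms that by (auto simp: disc_inner_def scalar_inner_def intro!: isometric_twist)
  ultimately show ?thesis
    unfolding disc_inner_def by blast
qed

lemma inner_homotopicI:
  fixes h :: "real \<Rightarrow> complex \<Rightarrow> complex^'n^'m"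
  assumes cont: "continuous_on ({0..1} \<times> cball 0 1) (\<lambda>(t, z). h t z)"
    and inner: "\<And>t. t \<in> {0..1} \<Longrightarrow> disc_inner (h t)"
    and "\<And>z. z \<in> cball 0 1 \<Longrightarrow> h 0 z = F z" "\<And>z. z \<in> cball 0 1 \<Longrightarrow> h 1 z = G z"
  shows "inner_homotopic F G"
proof -
  have "\<exists>k. continuous_map (prod_topology (top_of_set {0..1::real}) (top_of_set (cball 0 1))) euclidean k \<and>
      (\<forall>z\<in>topspace (top_of_set (cball 0 1)). k (0, z) = F z) \<and>
      (\<forall>z\<in>topspace (top_of_set (cball 0 1)). k (1, z) = G z) \<and>
      (\<forall>t\<in>{0..1}. disc_inner (\<lambda>z. k (t, z)))"
    using assms
    by (intro exI[of _ "\<lambda>(t, z). h t z"])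
      (auto simp: continuous_map_subtopology_eu simp flip: subtopology_Times euclidean_product_topology)
  moreover have "disc_inner f \<longleftrightarrow> disc_inner g"
    if "\<And>z. z \<in> topspace (top_of_set (cball 0 1)) \<Longrightarrow> f z = g z" for f g :: "complex \<Rightarrow> complex^'n^'m"
    using that by (intro disc_inner_cong) simp
  ultimately show ?thesis
    unfolding subtopology_UNIV by (subst homotopic_with) blast+
qed

lemma inner_homotopicE:
  assumes "inner_homotopic F (G :: complex \<Rightarrow> complex^'n^'m)"
  obtains h where "continuous_on ({0..1::real} \<times> cball 0 1) (\<lambda>(t, z). h t z)"
    "\<forall>t\<in>{0..1}. disc_inner (h t)" "h 0 = F" "h 1 = G"
proof -
  obtain k where k: "continuous_map (prod_topology (top_of_set {0..1::real}) (top_of_set (cball 0 1))) euclidean k"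
      "\<forall>z. k (0, z) = F z" "\<forall>z. k (1, z) = G z" "\<forall>t\<in>{0..1}. disc_inner (\<lambda>z. k (t, z))"
    using assms by (auto simp: homotopic_with_def)
  have "continuous_on ({0..1} \<times> cball 0 1) k"
    using k(1) by (simp add: continuous_map_subtopology_eu flip: subtopology_Times euclidean_product_topology)
  then have "continuous_on ({0..1} \<times> cball 0 1) (\<lambda>(t, z). k (t, z))" by simp
  with k show ?thesis by (intro that[of "\<lambda>t z. k (t, z)"]) auto
qed

lemma continuous_on_snd_cball:
  "continuous_on (cball 0 1) f \<Longrightarrow> continuous_on ({0..1::real} \<times> cball 0 1) (\<lambda>x. f (snd x))"
  by (rule continuous_on_compose2[of "cball 0 1" f]) (auto intro: continuous_intros)

lemma continuous_on_fst_interval: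
  "continuous_on {0..1} f \<Longrightarrow> continuous_on ({0..1::real} \<times> cball 0 1) (\<lambda>x. f (fst x))"
  by (rule continuous_on_compose2[of "{0..1}" f]) (auto intro: continuous_intros)

lemma inner_homotopic_twist:
  assumes "inner_homotopic F G" "scalar_inner b" "norm v = 1"
  shows "inner_homotopic (\<lambda>z. twist (b z) v (F z)) (\<lambda>z. twist (b z) v (G z))"
proof -
  obtain h where h: "continuous_on ({0..1::real} \<times> cball 0 1) (\<lambda>(t, z). h t z)"
    "\<forall>t\<in>{0..1}. disc_inner (h t)" "h 0 = F" "h 1 = G"
    using inner_homotopicE[OF assms(1)] by metis
  show ?thesis
  proof (rule inner_homotopicI[where h = "\<lambda>t z. twist (b z) v (h t z)"])
    show "continuous_on ({0..1} \<times> cball 0 1) (\<lambda>(t, z). twist (b z) v (h t z))"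
      using h(1) continuous_on_snd_cball[OF continuous_on_scalar_inner[OF assms(2)]]
      unfolding case_prod_unfold by (intro continuous_intros)
  qed (use h(2-4) assms(2,3) in \<open>auto intro: disc_inner_twist\<close>)
qed

text \<open>
  The unit sphere of \<open>complex^'m\<close> is connected, and the direction of a twist may move along it.
\<close>

lemma inner_homotopic_twist_vector:
  fixes v w :: "complex^'m"
  assumes "disc_inner F" "scalar_inner b" "norm v = 1" "norm w = 1"
  shows "inner_homotopic (\<lambda>z. twist (b z) v (F z)) (\<lambda>z. twist (b z) w (F z))"
proof -
  have "path_connected (sphere (0::complex^'m) 1)"
    by (rule path_connected_sphere) simp
  moreover have "v \<in> sphere 0 1" "w \<in> sphere 0 1" using assms by simp_all
  ultimately obtain g where g: "path g" "path_image g \<subseteq> sphere 0 1" "pathstart g = v" "pathfinish g = w"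
    unfolding path_connected_def by blast
  have unit: "norm (g t) = 1" if "t \<in> {0..1}" for t
  proof -
    have "g t \<in> sphere 0 1" using g(2) that unfolding path_image_def by blast
    then show ?thesis by simp
  qed
  show ?thesis
  proof (rule inner_homotopicI[where h = "\<lambda>t z. twist (b z) (g t) (F z)"])
    show "continuous_on ({0..1} \<times> cball 0 1) (\<lambda>(t, z). twist (b z) (g t) (F z))"
      unfolding case_prod_unfold
      by (intro continuous_intros continuous_on_snd_cball continuous_on_fst_interval
          continuous_on_scalar_inner continuous_on_disc_inner assms g(1)[unfolded path_def])
  qed (use g assms unit in \<open>auto intro: disc_inner_twist simp: pathstart_def pathfinish_def\<close>)
qed

lemma disc_inner_const: "isometric V \<Longrightarrow> disc_inner (\<lambda>_. V)"
  unfolding disc_inner_def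
  by (intro conjI exI[of _ "\<lambda>i j. [:V $ i $ j:]"] exI[of _ "1 :: complex poly"]) auto

lemma inner_homotopic_phase:
  assumes "isometric V" "norm v = 1"
  shows "inner_homotopic (\<lambda>_. V) (\<lambda>_. twist (cis t) v V)"
proof (rule inner_homotopicI[where h = "\<lambda>s z. twist (cis (s * t)) v V"])
  show "continuous_on ({0..1} \<times> cball 0 1) (\<lambda>(s, z::complex). twist (cis (s * t)) v V)"
    unfolding case_prod_unfold by (intro continuous_intros)
qed (use assms in \<open>auto intro!: disc_inner_const isometric_twist\<close>)

section \<open>Constant isometries\<close>

text \<open>
  Induction on the number of columns in which the two matrices differ. A reflection that moves one
  column to its target fixes the columns that agree already, because those are orthogonal both to the
  column and to its target.
\<close>

lemma isometric_constants_homotopic: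
  fixes V U :: "complex^'n^'m"
  assumes "isometric V" "isometric U"
  shows "inner_homotopic (\<lambda>_. V) (\<lambda>_. U)"
  using assms(1)
proof (induction "card {j. column j V \<noteq> column j U}" arbitrary: V rule: less_induct)
  case less
  show ?case
  proof (cases "V = U")
    case True
    then show ?thesis using assms(2) by (simp add: disc_inner_const)
  next
    case False
    then obtain j where j: "column j V \<noteq> column j U"
      by (auto simp: vec_eq_iff column_def)
    have unit: "norm (column k A) = 1" if "isometric A" for k and A :: "complex^'n^'m"
    proof -
      have "(norm (column k A))\<^sup>2 = 1\<^sup>2"
        using that cinner_self[of "column k A"] unfolding isometric_def
        by (metis of_real_1 of_real_eq_iff one_power2)
      then show ?thesis by (rule power2_eq_imp_eq) auto
    qed
    obtain t r where tr: "norm (r *s (column j V - column j U)) = 1"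
        "column j V + ((cis t - 1) * cinner (r *s (column j V - column j U)) (column j V))
            *s (r *s (column j V - column j U)) = column j U"
      using householder_reflection[OF unit[OF less.prems] unit[OF assms(2)] j] by metis
    define v where "v = r *s (column j V - column j U)"
    define V' where "V' = twist (cis t) v V"
    have V': "isometric V'"
      unfolding V'_def using tr(1) less.prems by (intro isometric_twist) (auto simp: v_def)
    have moved: "column j V' = column j U"
      using tr(2) by (simp add: V'_def column_twist v_def)
    have kept: "column k V' = column k U" if k: "column k V = column k U" for k
    proof -
      have "k \<noteq> j" using k j by auto
      then have "cinner (column j V) (column k V) = 0" "cinner (column j U) (column k U) = 0"
        using less.prems assms(2) by (auto simp: isometric_def)
      then have "cinner v (column k V) = 0"
        unfolding v_def cinner_scale_left cinner_diff_left by (simp add: k)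
      then show ?thesis using k by (simp add: V'_def column_twist)
    qed
    have "{k. column k V' \<noteq> column k U} \<subset> {k. column k V \<noteq> column k U}"
      using j moved kept by blast
    then have "inner_homotopic (\<lambda>_. V') (\<lambda>_. U)"
      by (intro less.hyps V') (simp add: psubset_card_mono)
    moreover have "inner_homotopic (\<lambda>_. V) (\<lambda>_. V')"
      unfolding V'_def using tr(1) by (intro inner_homotopic_phase less.prems) (simp add: v_def)
    ultimately show ?thesis by (rule homotopic_with_trans[rotated])
  qed
qed

definition coordinate_isometry :: "('n \<Rightarrow> 'm) \<Rightarrow> complex^'n^'m" where
  "coordinate_isometry \<sigma> = (\<chi> i j. if i = \<sigma> j then 1 else 0)"

lemma column_coordinate_isometry: "column j (coordinate_isometry \<sigma>) = axis (\<sigma> j) 1"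
  by (simp add: coordinate_isometry_def column_def axis_def vec_eq_iff)

lemma isometric_coordinate_isometry: "inj \<sigma> \<Longrightarrow> isometric (coordinate_isometry \<sigma>)"
  unfolding isometric_def column_coordinate_isometry cinner_axis by (auto simp: axis_def inj_eq)

text \<open>
  This is where having more rows than columns matters: the coordinate vector \<open>i\<close> is orthogonal to the
  range of the constant isometry, so a twist along it does nothing, and any other twist can be
  turned into that one.
\<close>

lemma inner_homotopic_remove_twist:
  fixes F :: "complex \<Rightarrow> complex^'n^'m"
  assumes \<sigma>: "inj \<sigma>" and i: "i \<notin> range \<sigma>" and b: "scalar_inner b" and v: "norm v = 1"
    and F: "inner_homotopic F (\<lambda>_. coordinate_isometry \<sigma>)"
  shows "inner_homotopic (\<lambda>z. twist (b z) v (F z)) (\<lambda>_. coordinate_isometry \<sigma>)"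
proof -
  let ?E = "coordinate_isometry \<sigma> :: complex^'n^'m"
  have "inner_homotopic (\<lambda>z. twist (b z) v (F z)) (\<lambda>z. twist (b z) v ?E)"
    by (intro inner_homotopic_twist F b v)
  also have "inner_homotopic \<dots> (\<lambda>z. twist (b z) (axis i 1) ?E)"
    by (intro inner_homotopic_twist_vector b v disc_inner_const isometric_coordinate_isometry \<sigma>)
      (simp add: norm_axis_1)
  also (homotopic_with_trans) have "(\<lambda>z. twist (b z) (axis i 1) ?E) = (\<lambda>_. ?E)"
    unfolding twist_def cinner_axis column_coordinate_isometry
    using i by (auto simp: axis_def vec_eq_iff fun_eq_iff)
  finally show ?thesis .
qed

section \<open>Reflected polynomials and the splitting of Blaschke-Potapov factors\<close>

text \<open>
  The reflection \<open>z\<^sup>N cnj (p (1 / cnj z))\<close> in the unit circle. The exponent \<open>N\<close> may exceed the degree of \<open>p\<close>;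
  then \<open>0\<close> is a root, which treats the pole at infinity like the finite ones.
\<close>

definition star :: "nat \<Rightarrow> complex poly \<Rightarrow> complex poly" where
  "star N p = (\<Sum>k\<le>N. monom (cnj (coeff p (N - k))) k)"

lemma star_add: "star N (p + q) = star N p + star N q"
  and star_diff: "star N (p - q) = star N p - star N q"
  and star_smult: "star N (smult c p) = smult (cnj c) (star N p)"
  and star_sum: "star N (\<Sum>i\<in>I. f i) = (\<Sum>i\<in>I. star N (f i))"
proof -
  have coeff_star: "coeff (star N p) k = (if k \<le> N then cnj (coeff p (N - k)) else 0)" for p k
    by (auto simp: star_def coeff_sum)
  show "star N (p + q) = star N p + star N q" "star N (p - q) = star N p - star N q"
    "star N (smult c p) = smult (cnj c) (star N p)"
    "star N (\<Sum>i\<in>I. f i) = (\<Sum>i\<in>I. star N (f i))"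
    by (simp_all add: poly_eq_iff coeff_star coeff_sum)
qed

lemma poly_star:
  assumes "degree p \<le> N" "z \<noteq> 0"
  shows "poly (star N p) z = z ^ N * cnj (poly p (1 / cnj z))"
proof -
  have "poly p (1 / cnj z) = (\<Sum>k\<le>N. coeff p k * (1 / cnj z) ^ k)"
    by (subst poly_as_sum_of_monoms'[OF assms(1), symmetric]) (simp add: poly_sum poly_monom)
  also have "\<dots> = (\<Sum>k\<le>N. coeff p (N - k) * (1 / cnj z) ^ (N - k))"
    by (rule sum.reindex_bij_witness[of _ "\<lambda>k. N - k" "\<lambda>k. N - k"]) auto
  finally have "z ^ N * cnj (poly p (1 / cnj z)) = (\<Sum>k\<le>N. cnj (coeff p (N - k)) * (z ^ N * (1 / z) ^ (N - k)))"
    by (simp add: sum_distrib_left mult_ac)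
  also have "\<dots> = (\<Sum>k\<le>N. cnj (coeff p (N - k)) * z ^ k)"
  proof (intro sum.cong refl, goal_cases)
    case (1 k)
    then have "z ^ N = z ^ (N - k) * z ^ k" by (simp flip: power_add)
    then show ?case using assms(2) by (simp add: power_one_over)
  qed
  finally show ?thesis by (simp add: star_def poly_sum poly_monom)
qed

lemma poly_star_0: "poly (star N p) 0 = cnj (coeff p N)"
proof -
  have "poly (star N p) 0 = (\<Sum>k\<le>N. if k = 0 then cnj (coeff p (N - k)) else 0)"
    unfolding star_def poly_sum poly_monom by (intro sum.cong) (auto simp: power_0_left)
  then show ?thesis by simp
qed

lemma poly_star_on_circle:
  assumes "degree p \<le> N" "norm z = 1"
  shows "poly (star N p) z = z ^ N * cnj (poly p z)"
proof -
  have "z * cnj z = 1" using assms(2) by (simp flip: complex_norm_square)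
  then have "1 / cnj z = z" by (metis mult_zero_right nonzero_eq_divide_eq zero_neq_one)
  moreover have "z \<noteq> 0" using assms(2) by auto
  ultimately show ?thesis using poly_star[OF assms(1), of z] by simp
qed

text \<open>
  A root \<open>a \<noteq> 0\<close> of the reflection is a root \<open>1 / cnj a\<close> of \<open>p\<close>; the root \<open>0\<close> means that the degree is
  smaller than \<open>Suc N\<close>. Both cases lower the degree bound.
\<close>

lemma star_root_iff:
  assumes "degree p \<le> Suc N"
  shows "poly (star (Suc N) p) a = 0 \<longleftrightarrow> (\<exists>s. degree s \<le> N \<and> p = [:1, - cnj a:] * s)"
proof (cases "a = 0")
  case True
  have "coeff p (Suc N) = 0 \<longleftrightarrow> degree p \<le> N"
    using assms by (metis coeff_eq_0 le_SucE le_imp_less_Suc leading_coeff_0_iff degree_0 zero_le)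
  then show ?thesis using True by (simp add: poly_star_0)
next
  case False
  define c where "c = 1 / cnj a"
  have root: "poly (star (Suc N) p) a = 0 \<longleftrightarrow> poly p c = 0"
    using poly_star[OF assms False] False by (simp add: c_def)
  have lin: "[:1, - cnj a:] = smult (- cnj a) [:- c, 1:]"
    using False by (simp add: c_def)
  show ?thesis
  proof
    assume "poly (star (Suc N) p) a = 0"
    then obtain t where t: "p = [:- c, 1:] * t"
      using root by (auto simp: poly_eq_0_iff_dvd)
    define s where "s = smult (- c) t"
    have "p = [:1, - cnj a:] * s"
      unfolding lin t s_def mult_smult_left mult_smult_right smult_smult using False by (simp add: c_def)
    moreover have "degree s \<le> N"
    proof (cases "t = 0")
      case False
      then have "degree p = Suc (degree t)" unfolding t by (subst degree_mult_eq) auto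
      then show ?thesis using assms degree_smult_le[of "- c" t] by (simp add: s_def)
    qed (simp add: s_def)
    ultimately show "\<exists>s. degree s \<le> N \<and> p = [:1, - cnj a:] * s" by blast
  next
    assume "\<exists>s. degree s \<le> N \<and> p = [:1, - cnj a:] * s"
    then have "poly p c = 0" using False by (auto simp: c_def)
    then show "poly (star (Suc N) p) a = 0" using root by simp
  qed
qed

lemma star_has_root_in_disc:
  assumes "degree q \<le> Suc N" "\<forall>z\<in>cball 0 1. poly q z \<noteq> 0"
  obtains a where "norm a < 1" "poly (star (Suc N) q) a = 0"
proof -
  have "coeff (star (Suc N) q) (Suc N) = cnj (coeff q 0)"
    unfolding star_def by (subst coeff_sum_monom) auto
  moreover have "coeff q 0 \<noteq> 0" using assms(2)[rule_format, of 0] by (simp add: poly_0_coeff_0)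
  \<comment> \<open>The coefficient of order \<open>Suc N\<close> is nonzero, so the fundamental theorem of algebra applies.\<close>
  ultimately have "degree (star (Suc N) q) \<noteq> 0" using le_degree[of "star (Suc N) q" "Suc N"] by auto
  then obtain a where a: "poly (star (Suc N) q) a = 0"
    using Fundamental_Theorem_Algebra.fundamental_theorem_of_algebra[of "star (Suc N) q"] by (auto simp: constant_degree)
  have "norm a < 1"
  proof (rule ccontr)
    assume "\<not> norm a < 1"
    then have "a \<noteq> 0" "1 / cnj a \<in> cball 0 1" by (auto simp: norm_divide divide_simps)
    moreover have "poly q (1 / cnj a) = 0"
      using poly_star[OF assms(1) \<open>a \<noteq> 0\<close>] a \<open>a \<noteq> 0\<close> by simp
    ultimately show False using assms(2) by blast
  qed
  then show ?thesis using a that by blast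
qed

definition inner_fraction ::
    "nat \<Rightarrow> ('m \<Rightarrow> 'n \<Rightarrow> complex poly) \<Rightarrow> complex poly \<Rightarrow> (complex \<Rightarrow> complex^'n^'m) \<Rightarrow> bool" where
  "inner_fraction N P q F \<longleftrightarrow>
     (\<forall>i j. degree (P i j) \<le> N) \<and> degree q \<le> N \<and>
     (\<forall>z\<in>cball 0 1. poly q z \<noteq> 0 \<and> (\<forall>i j. F z $ i $ j = poly (P i j) z / poly q z)) \<and>
     (\<forall>z\<in>sphere 0 1. isometric (F z))"

text \<open>
  On the circle the reflection is conjugation up to the factor \<open>z\<^sup>N\<close>, so there the identity is the
  isometry condition cleared of denominators; polynomials that agree on the circle are equal.
\<close>

lemma inner_fraction_star:
  assumes "inner_fraction N P q (F :: complex \<Rightarrow> complex^'n^'m)"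
  shows "(\<Sum>i\<in>UNIV. star N (P i j) * P i k) = (if j = k then star N q * q else 0)"
proof -
  define D where "D = (\<Sum>i\<in>UNIV. star N (P i j) * P i k) - (if j = k then star N q * q else 0)"
  have root: "poly D z = 0" if z: "z \<in> sphere 0 1" for z
  proof -
    have z1: "z \<in> cball 0 1" "norm z = 1" using z by auto
    have q: "poly q z \<noteq> 0" and F: "\<And>i j. F z $ i $ j = poly (P i j) z / poly q z"
      using assms z1 unfolding inner_fraction_def by blast+
    have "(\<Sum>i\<in>UNIV. cnj (poly (P i j) z) * poly (P i k) z) = (if j = k then cnj (poly q z) * poly q z else 0)"
    proof -
      have "cinner (column j (F z)) (column k (F z)) = (if j = k then 1 else 0)"
        using assms z by (auto simp: inner_fraction_def isometric_def)
      moreover have "cinner (column j (F z)) (column k (F z))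
          = (\<Sum>i\<in>UNIV. cnj (poly (P i j) z) * poly (P i k) z) / (cnj (poly q z) * poly q z)"
        by (simp add: cinner_def column_def F sum_divide_distrib)
      ultimately show ?thesis using q by (auto split: if_splits)
    qed
    moreover have "poly (star N (P i j)) z = z ^ N * cnj (poly (P i j) z)" for i
      using assms z1 by (intro poly_star_on_circle) (auto simp: inner_fraction_def)
    moreover have "poly (star N q) z = z ^ N * cnj (poly q z)"
      using assms z1 by (intro poly_star_on_circle) (auto simp: inner_fraction_def)
    ultimately show ?thesis
      by (simp add: D_def poly_sum mult.assoc flip: sum_distrib_left)
  qed
  have "D = 0"
  proof (rule ccontr)
    assume "D \<noteq> 0"
    then have "finite {z. poly D z = 0}" by (rule poly_roots_finite)
    then have "finite (sphere 0 1 :: complex set)"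
      by (rule finite_subset[rotated]) (use root in blast)
    moreover have "uncountable (sphere 0 1 :: complex set)"
      by (rule connected_uncountable[of _ 1 "-1"]) (auto intro: connected_sphere)
    ultimately show False by (simp add: countable_finite)
  qed
  then show ?thesis by (simp add: D_def)
qed

text \<open>
  The matrix \<open>L\<close> of the introduction: up to a scalar the value of \<open>P\<close> at \<open>1 / cnj a\<close> or, for \<open>a = 0\<close>,
  its coefficient of order \<open>N\<close>.
\<close>

definition star_matrix :: "nat \<Rightarrow> ('m \<Rightarrow> 'n \<Rightarrow> complex poly) \<Rightarrow> complex \<Rightarrow> complex^'n^'m" where
  "star_matrix N P a = (\<chi> i j. cnj (poly (star N (P i j)) a))"

text \<open>
  By \<open>inner_fraction_star\<close> at \<open>a\<close>, the rows combined with the entries of \<open>cnj v\<close> vanish at \<open>a\<close> when \<open>v\<close> is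
  the normalised column \<open>j\<close> of the leading matrix. Replacing their factor \<open>z - a\<close> by \<open>1 - cnj a * z\<close>
  inverts the twist and keeps the denominator and the degree bound. The added term is divisible by
  \<open>1 - cnj a * z\<close>, so its reflection vanishes at \<open>a\<close> and the leading matrix loses its component
  along \<open>v\<close>.
\<close>

lemma split_off_blaschke_factor:
  fixes F :: "complex \<Rightarrow> complex^'n^'m"
  assumes F: "inner_fraction (Suc N) P q F"
    and a: "norm a < 1" "poly (star (Suc N) q) a = 0"
    and j: "column j (star_matrix (Suc N) P a) \<noteq> 0"
  obtains P' F' v where "inner_fraction (Suc N) P' q F'" "norm v = 1"
    "\<And>z. z \<in> cball 0 1 \<Longrightarrow> F z = twist ((z - a) / (1 - cnj a * z)) v (F' z)"
    "star_matrix (Suc N) P' a = twist 0 v (star_matrix (Suc N) P a)"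
    "column j (star_matrix (Suc N) P' a) = 0"
proof -
  define L where "L = star_matrix (Suc N) P a"
  define c where "c = norm (column j L)"
  have c: "c > 0" using j by (simp add: c_def L_def)
  define v where "v = of_real (1 / c) *s column j L"
  have Lj: "column j L = of_real c *s v" using c by (simp add: v_def vector_smult_assoc)
  have v: "cinner v v = 1"
  proof -
    have "cinner (column j L) (column j L) = of_real (c\<^sup>2)" by (simp add: cinner_self c_def)
    then show ?thesis
      unfolding v_def cinner_scale_left cinner_scale_right using c by (simp add: power2_eq_square)
  qed
  have v1: "norm v = 1"
  proof -
    have "(norm v)\<^sup>2 = 1\<^sup>2" using v unfolding cinner_self by (simp flip: of_real_power)
    then show ?thesis by (rule power2_eq_imp_eq) auto
  qed
  have deg: "\<And>i k. degree (P i k) \<le> Suc N" and degq: "degree q \<le> Suc N"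
    using F by (auto simp: inner_fraction_def)
  define r where "r k = (\<Sum>i\<in>UNIV. smult (cnj (v $ i)) (P i k))" for k
  have degr: "degree (r k) \<le> Suc N" for k
    unfolding r_def by (intro degree_sum_le) (auto intro: order_trans[OF degree_smult_le] deg)
  have "\<exists>s. r k = [:- a, 1:] * s \<and> degree s \<le> N" for k
  proof -
    have "(\<Sum>i\<in>UNIV. poly (star (Suc N) (P i j)) a * poly (P i k) a) = 0"
      using arg_cong[OF inner_fraction_star[OF F, of j k], of "\<lambda>p. poly p a"] a(2)
      by (simp add: poly_sum split: if_splits)
    moreover have "v $ i = of_real (1 / c) * cnj (poly (star (Suc N) (P i j)) a)" for i
      by (simp add: v_def L_def star_matrix_def column_def)
    ultimately have "poly (r k) a = 0"
      by (simp add: r_def poly_sum flip: sum_divide_distrib)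
    then obtain s where s: "r k = [:- a, 1:] * s" by (auto simp: poly_eq_0_iff_dvd)
    have "degree s \<le> N"
    proof (cases "s = 0")
      case False
      then have "degree (r k) = Suc (degree s)" unfolding s by (subst degree_mult_eq) auto
      then show ?thesis using degr[of k] by simp
    qed simp
    with s show ?thesis by blast
  qed
  then obtain s where s: "\<And>k. r k = [:- a, 1:] * s k" "\<And>k. degree (s k) \<le> N" by metis
  define P' where "P' i k = P i k - smult (v $ i) (r k) + smult (v $ i) ([:1, - cnj a:] * s k)" for i k
  define F' :: "complex \<Rightarrow> complex^'n^'m" where "F' z = (\<chi> i k. poly (P' i k) z / poly q z)" for z
  let ?b = "\<lambda>z. (z - a) / (1 - cnj a * z)"
  have Fz: "poly q z \<noteq> 0" "F z $ i $ k = poly (P i k) z / poly q z" if "z \<in> cball 0 1" for z i k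
    using F that by (auto simp: inner_fraction_def)
  have twisted: "F z = twist (?b z) v (F' z)" if z: "z \<in> cball 0 1" for z
  proof -
    have nz: "1 - cnj a * z \<noteq> 0" using one_minus_cnj_mult_nonzero[OF a(1)] z by simp
    have "cinner v (column k (F' z)) = (1 - cnj a * z) * poly (s k) z / poly q z" for k
    proof -
      have "cinner v (column k (F' z)) = (\<Sum>i\<in>UNIV. cnj (v $ i) * poly (P' i k) z) / poly q z"
        by (simp add: cinner_def column_def F'_def sum_divide_distrib)
      also have "(\<Sum>i\<in>UNIV. cnj (v $ i) * poly (P' i k) z)
          = (\<Sum>i\<in>UNIV. cnj (v $ i) * poly (P i k) z
              + cnj (v $ i) * v $ i * (poly ([:1, - cnj a:] * s k) z - poly (r k) z))"
        unfolding P'_def by (intro sum.cong) (simp_all add: algebra_simps)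
      also have "\<dots> = poly (r k) z
          + cinner v v * (poly ([:1, - cnj a:] * s k) z - poly (r k) z)"
        unfolding sum.distrib sum_distrib_right[symmetric] by (simp add: r_def poly_sum cinner_def)
      finally show ?thesis by (simp add: v algebra_simps)
    qed
    then have "twist (?b z) v (F' z) $ i $ k
        = poly (P' i k) z / poly q z + (?b z - 1) * v $ i * ((1 - cnj a * z) * poly (s k) z / poly q z)" for i k
      by (simp add: twist_def F'_def)
    also have "\<dots> i k = poly (P' i k) z / poly q z
        + v $ i * (((z - a) - (1 - cnj a * z)) * poly (s k) z) / poly q z" for i k
      using nz Fz(1)[OF z] by (simp add: divide_simps)
    also have "\<dots> i k = poly (P i k) z / poly q z" for i k
      using Fz(1)[OF z] by (simp add: P'_def s(1) divide_simps algebra_simps)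
    finally show ?thesis using Fz[OF z] by (simp add: vec_eq_iff)
  qed
  \<comment> \<open>On the circle the twist has modulus one, and its inverse recovers the new function.\<close>
  have "isometric (F' z)" if z: "z \<in> sphere 0 1" for z
  proof -
    have "norm (?b z) = 1" using scalar_inner_blaschke[OF a(1)] z by (simp add: scalar_inner_def)
    then have "?b z \<noteq> 0" "norm (inverse (?b z)) = 1" unfolding norm_inverse by auto
    moreover have "isometric (F z)" using F z by (auto simp: inner_fraction_def)
    moreover have "twist (inverse (?b z)) v (F z) = F' z"
      using twisted[of z] z \<open>?b z \<noteq> 0\<close> by (simp add: twist_twist v1)
    ultimately show ?thesis using isometric_twist[of "inverse (?b z)" v "F z"] v1 by simp
  qed
  moreover have "degree (P' i k) \<le> Suc N" for i k
  proof -
    have "degree ([:1, - cnj a:] * s k) \<le> Suc N"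
      using degree_mult_le[of "[:1, - cnj a:]" "s k"] s(2)[of k] by (auto intro: order_trans)
    then show ?thesis unfolding P'_def
      by (intro degree_add_le degree_diff_le deg degr order_trans[OF degree_smult_le])
  qed
  ultimately have inner: "inner_fraction (Suc N) P' q F'"
    using F by (auto simp: inner_fraction_def F'_def)
  have L': "star_matrix (Suc N) P' a = twist 0 v L"
  proof -
    have "poly (star (Suc N) ([:1, - cnj a:] * s k)) a = 0" for k
    proof (subst star_root_iff)
      show "degree ([:1, - cnj a:] * s k) \<le> Suc N"
        using degree_mult_le[of "[:1, - cnj a:]" "s k"] s(2)[of k] by (auto intro: order_trans)
    qed (use s(2) in blast)
    moreover have "cnj (poly (star (Suc N) (r k)) a) = cinner v (column k L)" for k
      by (simp add: r_def star_sum star_smult poly_sum cinner_def L_def star_matrix_def column_def)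
    ultimately have "cnj (poly (star (Suc N) (P' i k)) a) = L $ i $ k + (0 - 1) * v $ i * cinner v (column k L)"
      for i k
      unfolding P'_def star_add star_diff star_smult by (simp add: L_def star_matrix_def)
    then show ?thesis by (simp add: star_matrix_def twist_def vec_eq_iff)
  qed
  moreover have "column j (twist 0 v L) = 0"
    unfolding column_twist Lj cinner_scale_right v by (simp add: vec_eq_iff)
  ultimately show ?thesis
    using that[of P' F' v] inner v1 twisted by (simp add: L_def)
qed

lemma cancel_common_factor:
  assumes F: "inner_fraction (Suc N) P q F"
    and a: "poly (star (Suc N) q) a = 0" "star_matrix (Suc N) P a = 0"
  obtains P' q' where "inner_fraction N P' q' F"
proof -
  have deg: "\<And>i k. degree (P i k) \<le> Suc N" and degq: "degree q \<le> Suc N"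
    using F by (auto simp: inner_fraction_def)
  have "poly (star (Suc N) (P i j)) a = 0" for i j
    using a(2) by (simp add: star_matrix_def vec_eq_iff)
  then have "\<forall>i j. \<exists>s. degree s \<le> N \<and> P i j = [:1, - cnj a:] * s"
    using star_root_iff[OF deg, of _ _ a] by blast
  then obtain P' where P': "\<And>i j. degree (P' i j) \<le> N" "\<And>i j. P i j = [:1, - cnj a:] * P' i j"
    by metis
  obtain q' where q': "degree q' \<le> N" "q = [:1, - cnj a:] * q'"
    using star_root_iff[OF degq, of a] a(1) by blast
  have "poly q' z \<noteq> 0 \<and> F z $ i $ j = poly (P' i j) z / poly q' z" if z: "z \<in> cball 0 1" for z i j
  proof -
    have "poly q z \<noteq> 0" "F z $ i $ j = poly (P i j) z / poly q z"
      using F z by (auto simp: inner_fraction_def)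
    then show ?thesis unfolding P'(2) q'(2) poly_mult by auto
  qed
  then have "inner_fraction N P' q' F"
    using F P'(1) q'(1) unfolding inner_fraction_def by blast
  then show ?thesis by (rule that)
qed

lemma inner_fraction_disc_inner: "inner_fraction N P q F \<Longrightarrow> disc_inner F"
  unfolding inner_fraction_def disc_inner_def by blast

text \<open>
  The outer induction is on the degree bound. For a fixed bound the denominator and the root \<open>a\<close> stay
  the same while the inner induction decreases the number of nonzero columns of the leading matrix.
\<close>

lemma inner_fraction_homotopic:
  fixes F :: "complex \<Rightarrow> complex^'n^'m"
  assumes \<sigma>: "inj \<sigma>" and i: "i \<notin> range \<sigma>"
  shows "inner_fraction N P q F \<Longrightarrow> inner_homotopic F (\<lambda>_. coordinate_isometry \<sigma>)"
proof (induction N arbitrary: P q F)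
  case 0
  have const: "F z = F 1" if "z \<in> cball 0 1" for z
  proof -
    have "degree (P i j) = 0" for i j using 0 by (simp add: inner_fraction_def)
    then have "poly (P i j) z = poly (P i j) 1" for i j by (metis degree_0_id poly_const_conv)
    moreover have "poly q z = poly q 1" using 0 by (simp add: inner_fraction_def) (metis degree_0_id poly_const_conv)
    ultimately show ?thesis using 0 that by (auto simp: inner_fraction_def vec_eq_iff)
  qed
  have iso: "isometric (F 1)" using 0 by (auto simp: inner_fraction_def)
  have "inner_homotopic F (\<lambda>_. F 1)"
  proof (rule homotopic_with_equal)
    show "continuous_map (top_of_set (cball 0 1)) (top_of_set UNIV) F"
      using continuous_on_disc_inner[OF inner_fraction_disc_inner[OF 0]] by simp
    show "disc_inner F" by (rule inner_fraction_disc_inner[OF 0])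
    show "disc_inner (\<lambda>_. F 1)" by (rule disc_inner_const[OF iso])
    show "F z = F 1" if "z \<in> topspace (top_of_set (cball 0 1))" for z
      using that by (intro const) simp
  qed
  moreover have "inner_homotopic (\<lambda>_. F 1) (\<lambda>_. coordinate_isometry \<sigma>)"
    by (intro isometric_constants_homotopic iso isometric_coordinate_isometry \<sigma>)
  ultimately show ?case by (rule homotopic_with_trans)
next
  case (Suc N)
  have "degree q \<le> Suc N" "\<forall>z\<in>cball 0 1. poly q z \<noteq> 0"
    using Suc.prems by (auto simp: inner_fraction_def)
  then obtain a where a: "norm a < 1" "poly (star (Suc N) q) a = 0"
    by (rule star_has_root_in_disc)
  let ?cols = "\<lambda>P. {j. column j (star_matrix (Suc N) P a :: complex^'n^'m) \<noteq> 0}"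
  show ?case using Suc.prems
  proof (induction "card (?cols P)" arbitrary: P F rule: less_induct)
    case less
    show ?case
    proof (cases "?cols P = {}")
      case True
      then have "star_matrix (Suc N) P a = (0 :: complex^'n^'m)"
        by (auto simp: vec_eq_iff column_def)
      then show ?thesis using cancel_common_factor[OF less.prems a(2)] Suc.IH by metis
    next
      case False
      then obtain j where j: "column j (star_matrix (Suc N) P a :: complex^'n^'m) \<noteq> 0" by blast
      obtain P' F' v where 1: "inner_fraction (Suc N) P' q F'" and v: "norm v = 1"
        and F: "\<And>z. z \<in> cball 0 1 \<Longrightarrow> F z = twist ((z - a) / (1 - cnj a * z)) v (F' z)"
        and L: "star_matrix (Suc N) P' a = twist 0 v (star_matrix (Suc N) P a)"
          "column j (star_matrix (Suc N) P' a) = 0"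
        using split_off_blaschke_factor[OF less.prems a j] by metis
      have "?cols P' \<subset> ?cols P"
      proof
        show "?cols P' \<subseteq> ?cols P"
          unfolding L(1) column_twist by (auto simp: cinner_def)
        show "?cols P' \<noteq> ?cols P" using j L(2) by blast
      qed
      then have "inner_homotopic F' (\<lambda>_. coordinate_isometry \<sigma>)"
        by (intro less.hyps[OF _ 1]) (simp add: psubset_card_mono)
      then have "inner_homotopic (\<lambda>z. twist ((z - a) / (1 - cnj a * z)) v (F' z)) (\<lambda>_. coordinate_isometry \<sigma>)"
        by (intro inner_homotopic_remove_twist[OF \<sigma> i scalar_inner_blaschke[OF a(1)] v])
      moreover have "inner_homotopic F (\<lambda>z. twist ((z - a) / (1 - cnj a * z)) v (F' z))"
        using F inner_fraction_disc_inner[OF less.prems]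
          disc_inner_twist[OF inner_fraction_disc_inner[OF 1] scalar_inner_blaschke[OF a(1)] v]
        by (intro homotopic_with_equal) (auto simp: continuous_on_disc_inner)
      ultimately show ?thesis by (rule homotopic_with_trans[rotated])
    qed
  qed
qed

section \<open>Rational inner functions with the supremum norm\<close>

lemma norm_entry_le_onorm:
  fixes A :: "complex^'n^'m"
  shows "norm (A $ i $ j) \<le> onorm (\<lambda>x. A *v x)"
proof -
  have "A *v axis j 1 = column j A"
    by (simp add: matrix_vector_mult_def column_def axis_def vec_eq_iff if_distrib cong: if_cong)
  moreover have "norm (A *v axis j 1) \<le> onorm (\<lambda>x. A *v x) * norm (axis j (1::complex))"
    by (rule onorm) auto
  moreover have "norm (axis j (1::complex)) = 1" by (simp add: norm_axis_1)
  ultimately have "norm (column j A) \<le> onorm (\<lambda>x. A *v x)" by simp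
  moreover have "norm (A $ i $ j) \<le> norm (column j A)"
    using Finite_Cartesian_Product.norm_nth_le[of "column j A" i] by (simp add: column_def)
  ultimately show ?thesis by linarith
qed

lemma onorm_le_norm:
  fixes A :: "complex^'n^'m"
  shows "onorm (\<lambda>x. A *v x) \<le> real CARD('m) * real CARD('n) * norm A"
proof (rule onorm_bound)
  fix x :: "complex^'n"
  have "norm ((A *v x) $ i) \<le> real CARD('n) * norm A * norm x" for i
  proof -
    have "norm ((A *v x) $ i) \<le> (\<Sum>j\<in>UNIV. norm (A $ i $ j) * norm (x $ j))"
      unfolding matrix_vector_mult_def vec_lambda_beta
      by (rule order_trans[OF norm_sum]) (simp add: norm_mult)
    also have "\<dots> \<le> (\<Sum>j\<in>(UNIV::'n set). norm A * norm x)"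
      by (intro sum_mono mult_mono order_trans[OF Finite_Cartesian_Product.norm_nth_le]
          Finite_Cartesian_Product.norm_nth_le) auto
    finally show ?thesis by simp
  qed
  then have "(\<Sum>i\<in>UNIV. norm ((A *v x) $ i)) \<le> (\<Sum>i\<in>(UNIV::'m set). real CARD('n) * norm A * norm x)"
    by (rule sum_mono)
  moreover have "norm (A *v x) \<le> (\<Sum>i\<in>UNIV. norm ((A *v x) $ i))"
    unfolding norm_vec_def[of "A *v x"] by (rule L2_set_le_sum) simp
  ultimately show "norm (A *v x) \<le> real CARD('m) * real CARD('n) * norm A * norm x"
    by (simp add: mult_ac)
qed simp

text \<open>
  If a denominator had a zero \<open>w\<close> in the closed disk, the bound \<open>\<bar>p\<bar> \<le> B \<bar>q\<bar>\<close> would pass to the limit \<open>w\<close>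
  from inside the open disk and give a common zero of numerator and denominator.
\<close>

lemma bounded_rational_function_no_pole:
  assumes f: "rational_function f" and bound: "\<And>z. z \<in> ball 0 1 \<Longrightarrow> norm (f z) \<le> B"
  obtains p q where "\<And>z. z \<in> cball 0 1 \<Longrightarrow> poly q z \<noteq> 0" "\<And>z. f z = poly p z / poly q z"
proof -
  obtain p q where pq: "q \<noteq> 0" "coprime p q" "\<And>z. f z = poly p z / poly q z"
    using f unfolding rational_function_def by blast
  have "poly q w \<noteq> 0" if w: "w \<in> cball 0 1" for w
  proof
    assume qw: "poly q w = 0"
    let ?F = "at w within ball 0 1"
    have "w islimpt ball 0 1" using w by (simp add: islimpt_ball)
    then have nontriv: "?F \<noteq> bot" by (simp add: trivial_limit_within)
    have "closed ({z. poly q z = 0} - {w})"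
      using poly_roots_finite[OF pq(1)] by (intro finite_imp_closed) auto
    then have "open (- ({z. poly q z = 0} - {w}))" by (rule open_Compl)
    then have "eventually (\<lambda>z. poly q z \<noteq> 0) ?F"
      unfolding eventually_at_topological
      by (intro exI[of _ "- ({z. poly q z = 0} - {w})"] conjI) auto
    then have ev: "eventually (\<lambda>z. norm (poly p z) \<le> B * norm (poly q z)) ?F"
      unfolding eventually_at_filter
    proof eventually_elim
      case (elim z)
      then show ?case
        using bound[of z] by (auto simp: pq(3) norm_divide divide_simps)
    qed
    have "((\<lambda>z. norm (poly p z)) \<longlongrightarrow> norm (poly p w)) ?F"
      by (intro tendsto_intros)
    moreover have "((\<lambda>z. B * norm (poly q z)) \<longlongrightarrow> B * norm (poly q w)) ?F"
      by (intro tendsto_intros)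
    ultimately have "norm (poly p w) \<le> B * norm (poly q w)"
      by (intro tendsto_le[OF nontriv]) (use ev in auto)
    then have "poly p w = 0" using qw by simp
    then show False using qw pq(2) by (metis coprime_poly_0)
  qed
  then show ?thesis using that pq(3) by blast
qed

lemma RIF_inner_fraction:
  fixes W :: "complex \<Rightarrow> complex^'n^'m"
  assumes W: "W \<in> RIF"
  obtains N P q where "inner_fraction N P q W"
proof -
  have bound: "norm (W z $ i $ j) \<le> 1" if z: "z \<in> ball 0 1" for z i j
  proof -
    have "ennreal (onorm (\<lambda>x. W z *v x)) \<le> sup_norm W"
      unfolding sup_norm_def using z by (rule SUP_upper)
    also have "\<dots> \<le> 1" using W by (simp add: RIF_def rational_inner_def)
    finally show ?thesis using norm_entry_le_onorm[of "W z" i j] by simp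
  qed
  have "\<exists>p q. (\<forall>z\<in>cball 0 1. poly q z \<noteq> 0) \<and> (\<forall>z. W z $ i $ j = poly p z / poly q z)" for i j
  proof -
    have "rational_function (\<lambda>z. W z $ i $ j)"
      using W by (simp add: RIF_def rational_inner_def rational_matrix_function_def)
    from bounded_rational_function_no_pole[OF this bound] show ?thesis by metis
  qed
  then obtain p q where pq: "\<And>i j z. z \<in> cball 0 1 \<Longrightarrow> poly (q i j) z \<noteq> 0"
      "\<And>i j z. W z $ i $ j = poly (p i j) z / poly (q i j) z"
    by metis
  \<comment> \<open>A common denominator for all entries.\<close>
  define Q where "Q = (\<Prod>(i, j)\<in>UNIV. q i j)"
  define P where "P i j = p i j * (\<Prod>(k, l)\<in>UNIV - {(i, j)}. q k l)" for i j
  define N where "N = (\<Sum>(i, j)\<in>UNIV. degree (P i j)) + degree Q"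
  have "degree (P i j) \<le> N" for i j
    using member_le_sum[of "(i, j)" UNIV "\<lambda>(i, j). degree (P i j)"] by (simp add: N_def)
  moreover have "degree Q \<le> N" by (simp add: N_def)
  moreover have "poly Q z \<noteq> 0" if "z \<in> cball 0 1" for z
    using pq(1)[OF that] by (auto simp: Q_def poly_prod)
  moreover have "W z $ i $ j = poly (P i j) z / poly Q z" if z: "z \<in> cball 0 1" for z i j
  proof -
    have Q: "Q = q i j * (\<Prod>(k, l)\<in>UNIV - {(i, j)}. q k l)"
      unfolding Q_def by (subst prod.remove[of _ "(i, j)"]) auto
    have "poly (\<Prod>(k, l)\<in>UNIV - {(i, j)}. q k l) z \<noteq> 0"
      using pq(1)[OF z] by (auto simp: poly_prod)
    then show ?thesis by (simp add: pq(2) P_def Q)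
  qed
  moreover have "isometric (W z)" if z: "z \<in> sphere 0 1" for z
  proof -
    have "z = cis (Arg2pi z)" "Arg2pi z \<in> {0..2*pi}"
      using Arg2pi[of z] z by (auto simp: cis_conv_exp is_Arg_def)
    then obtain \<theta> where "z = cis \<theta>" "\<theta> \<in> {0..2*pi}" by blast
    then show ?thesis
      using W by (simp add: RIF_def rational_inner_def isometric_iff)
  qed
  ultimately have "inner_fraction N P Q W" unfolding inner_fraction_def by blast
  then show ?thesis by (rule that)
qed

text \<open>
  The maximum principle, applied to the scalar function \<open>w \<mapsto> cinner y (F w *v x)\<close> with
  \<open>y = F z *v x\<close>; its value at \<open>z\<close> is \<open>\<bar>y\<bar>\<^sup>2\<close>.
\<close>

lemma disc_inner_contraction:
  fixes F :: "complex \<Rightarrow> complex^'n^'m"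
  assumes F: "disc_inner F" and z: "z \<in> cball 0 1"
  shows "norm (F z *v x) \<le> norm x"
proof -
  obtain P q where PQ: "\<And>w. w \<in> cball 0 1 \<Longrightarrow> poly q w \<noteq> 0"
      "\<And>w i j. w \<in> cball 0 1 \<Longrightarrow> F w $ i $ j = poly (P i j) w / poly q w"
    using F unfolding disc_inner_def by blast
  define y where "y = F z *v x"
  define f where "f w = cinner y (F w *v x)" for w
  have f: "f w = (\<Sum>i\<in>UNIV. cnj (y $ i) * (\<Sum>j\<in>UNIV. poly (P i j) w / poly q w * x $ j))"
    if "w \<in> cball 0 1" for w
    by (simp add: f_def cinner_def matrix_vector_mult_def PQ(2)[OF that])
  have "norm (f z) \<le> norm y * norm x"
  proof (rule maximum_modulus_frontier[of f "cball 0 1"])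
    have "(\<lambda>w. \<Sum>i\<in>UNIV. cnj (y $ i) * (\<Sum>j\<in>UNIV. poly (P i j) w / poly q w * x $ j)) holomorphic_on ball 0 1"
      using PQ(1) by (intro holomorphic_intros) auto
    then show "f holomorphic_on interior (cball 0 1)"
      using f by (subst holomorphic_cong[OF refl]) auto
    have "continuous_on (cball 0 1)
        (\<lambda>w. \<Sum>i\<in>UNIV. cnj (y $ i) * (\<Sum>j\<in>UNIV. poly (P i j) w / poly q w * x $ j))"
      using PQ(1) by (intro continuous_intros) auto
    then show "continuous_on (closure (cball 0 1)) f"
      using f by (subst continuous_on_cong[OF refl]) auto
    fix w :: complex assume "w \<in> frontier (cball 0 1)"
    then have "isometric (F w)" using F by (simp add: disc_inner_def)
    then show "norm (f w) \<le> norm y * norm x"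
      using norm_cinner_le[of y "F w *v x"] by (simp add: f_def norm_isometric)
  qed (use z in auto)
  moreover have "norm (f z) = norm y * norm y"
    by (simp add: f_def cinner_self power2_eq_square norm_mult flip: y_def)
  ultimately have "norm y * norm y \<le> norm y * norm x" by simp
  then have "norm y \<le> norm x" by (cases "y = 0") auto
  then show ?thesis by (simp add: y_def)
qed

lemma rational_function_exists:
  assumes "q \<noteq> 0"
  obtains f where "rational_function f" "\<And>z. poly q z \<noteq> 0 \<Longrightarrow> f z = poly p z / poly q z"
proof -
  have "gcd p q \<noteq> 0" using assms by simp
  then obtain r s where rs: "p = r * gcd p q" "q = s * gcd p q" "coprime r s"
    using gcd_coprime_exists[of p q] by blast
  have "s \<noteq> 0" using rs(2) assms by auto
  then have "rational_function (\<lambda>z. poly r z / poly s z)"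
    unfolding rational_function_def using rs(3) by blast
  moreover have "poly r z / poly s z = poly p z / poly q z" if "poly q z \<noteq> 0" for z
  proof -
    have "poly p z = poly r z * poly (gcd p q) z" "poly q z = poly s z * poly (gcd p q) z"
      using rs(1,2) by (metis poly_mult)+
    then show ?thesis using that by auto
  qed
  ultimately show ?thesis by (rule that)
qed

text \<open>
  The entries are given on the closed disk by fractions with a denominator that has no zero there, so
  the reduced fractions have the same values on it.
\<close>

lemma disc_inner_RIF:
  fixes F :: "complex \<Rightarrow> complex^'n^'m"
  assumes F: "disc_inner F"
  shows "\<exists>W\<in>RIF. \<forall>z\<in>cball 0 1. W z = F z"
proof -
  obtain P q where PQ: "\<And>w. w \<in> cball 0 1 \<Longrightarrow> poly q w \<noteq> 0"
      "\<And>w i j. w \<in> cball 0 1 \<Longrightarrow> F w $ i $ j = poly (P i j) w / poly q w"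
    using F unfolding disc_inner_def by blast
  have "q \<noteq> 0" using PQ(1)[of 0] by auto
  then have "\<exists>f. rational_function f \<and> (\<forall>z. poly q z \<noteq> 0 \<longrightarrow> f z = poly (P i j) z / poly q z)" for i j
    using rational_function_exists by metis
  then obtain f where f: "\<And>i j. rational_function (f i j)"
      "\<And>i j z. poly q z \<noteq> 0 \<Longrightarrow> f i j z = poly (P i j) z / poly q z"
    by metis
  define W :: "complex \<Rightarrow> complex^'n^'m" where "W z = (\<chi> i j. f i j z)" for z
  have WF: "W z = F z" if "z \<in> cball 0 1" for z
    using PQ[OF that] f(2) by (simp add: W_def vec_eq_iff)
  have "rational_matrix_function W"
    by (simp add: rational_matrix_function_def W_def f(1))
  moreover have "sup_norm W \<le> 1"
    unfolding sup_norm_def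
  proof (rule SUP_least)
    fix z :: complex assume "z \<in> ball 0 1"
    then have z: "z \<in> cball 0 1" by simp
    have "onorm (\<lambda>x. W z *v x) \<le> 1"
      using disc_inner_contraction[OF F z] by (intro onorm_bound) (auto simp: WF[OF z])
    then show "ennreal (onorm (\<lambda>x. W z *v x)) \<le> 1" by simp
  qed
  moreover have "conj_transpose (W (cis \<theta>)) ** W (cis \<theta>) = mat 1" for \<theta>
    using F WF[of "cis \<theta>"] by (simp add: disc_inner_def flip: isometric_iff)
  ultimately have "W \<in> RIF" by (simp add: RIF_def rational_inner_def)
  then show ?thesis using WF by blast
qed

lemma RIF_dist_le:
  fixes V W :: "complex \<Rightarrow> complex^'n^'m"
  assumes "\<And>z. z \<in> ball 0 1 \<Longrightarrow> norm (V z - W z) \<le> e"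
  shows "RIF_dist V W \<le> real CARD('m) * real CARD('n) * e"
proof -
  have e: "0 \<le> e" by (rule order_trans[OF norm_ge_zero assms[of 0]]) simp
  have "onorm (\<lambda>x. (V z - W z) *v x) \<le> real CARD('m) * real CARD('n) * e" if "z \<in> ball 0 1" for z
    using assms[OF that] by (intro order_trans[OF onorm_le_norm] mult_left_mono) auto
  then have "sup_norm (\<lambda>z. V z - W z) \<le> ennreal (real CARD('m) * real CARD('n) * e)"
    unfolding sup_norm_def by (intro SUP_least ennreal_leI)
  then show ?thesis
    unfolding RIF_dist_def using e by (intro enn2real_leI) auto
qed

text \<open>
  The homotopy is uniformly continuous on the compact set \<open>{0..1} \<times> cball 0 1\<close>, and that is continuity
  of \<open>t \<mapsto> h t\<close> for the supremum norm. The intermediate functions are first extended to elements of the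
  space.
\<close>

lemma inner_homotopic_path_component:
  fixes V W :: "complex \<Rightarrow> complex^'n^'m"
  assumes V: "V \<in> RIF" and W: "W \<in> RIF" and VW: "inner_homotopic V W"
  shows "path_component_of (Metric_space.mtopology RIF RIF_dist) V W"
proof -
  interpret Metric_space "RIF :: (complex \<Rightarrow> complex^'n^'m) set" RIF_dist
    by (rule Metric_space_RIF)
  obtain h where h: "continuous_on ({0..1::real} \<times> cball 0 1) (\<lambda>(t, z). h t z)"
    "\<forall>t\<in>{0..1}. disc_inner (h t)" "h 0 = V" "h 1 = W"
    using inner_homotopicE[OF VW] by metis
  have "\<forall>t\<in>{0..1}. \<exists>U\<in>RIF. \<forall>z\<in>cball 0 1. U z = h t z"
    using h(2) disc_inner_RIF by blast
  then obtain g where g: "\<And>t. t \<in> {0..1} \<Longrightarrow> g t \<in> RIF"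
      "\<And>t z. t \<in> {0..1} \<Longrightarrow> z \<in> cball 0 1 \<Longrightarrow> g t z = h t z"
    by metis
  define C where "C = real CARD('m) * real CARD('n)"
  have C: "C > 0" by (simp add: C_def)
  \<comment> \<open>An element of the space is determined by its values on the disk.\<close>
  have eq: "A = B" if "A \<in> RIF" "B \<in> RIF" "\<And>z. z \<in> cball 0 1 \<Longrightarrow> A z = B z"
    for A B :: "complex \<Rightarrow> complex^'n^'m"
  proof -
    have "RIF_dist A B \<le> real CARD('m) * real CARD('n) * 0"
      using that(3) by (intro RIF_dist_le) simp
    then show ?thesis using zero[OF that(1,2)] nonneg[of A B] by simp
  qed
  have "continuous_map (top_of_set {0..1}) mtopology g"
    unfolding continuous_map_to_metric
  proof (intro ballI allI impI)
    fix t :: real and e :: real assume t: "t \<in> topspace (top_of_set {0..1})" and e: "e > 0"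
    have "uniformly_continuous_on ({0..1::real} \<times> cball 0 1) (\<lambda>(t, z). h t z)"
      by (intro compact_uniformly_continuous h(1) compact_Times) auto
    moreover have "e / (2 * C) > 0" using e C by simp
    ultimately obtain d where d: "d > 0" and close: "\<And>x y. x \<in> {0..1::real} \<times> cball 0 1 \<Longrightarrow>
        y \<in> {0..1} \<times> cball 0 1 \<Longrightarrow> dist y x < d \<Longrightarrow>
        dist (case y of (t, z) \<Rightarrow> h t z) (case x of (t, z) \<Rightarrow> h t z) < e / (2 * C)"
      unfolding uniformly_continuous_on_def by metis
    have near: "g s \<in> mball (g t) e" if s: "s \<in> {0..1} \<inter> ball t d" for s
    proof -
      have "norm (g t z - g s z) \<le> e / (2 * C)" if z: "z \<in> ball 0 1" for z
      proof -
        have "dist (t, z) (s, z) < d" using s by (simp add: dist_Pair_Pair)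
        then have "dist (h t z) (h s z) < e / (2 * C)"
          using close[of "(s, z)" "(t, z)"] s t z by auto
        then show ?thesis using g(2) s t z by (simp add: dist_norm)
      qed
      then have "RIF_dist (g t) (g s) \<le> C * (e / (2 * C))"
        unfolding C_def by (rule RIF_dist_le)
      also have "\<dots> < e" using C e by simp
      finally show ?thesis using g(1) s t by simp
    qed
    show "\<exists>U. openin (top_of_set {0..1}) U \<and> t \<in> U \<and> (\<forall>s\<in>U. g s \<in> mball (g t) e)"
      using t d near by (intro exI[of _ "{0..1} \<inter> ball t d"]) (auto simp: openin_open_Int)
  qed
  moreover have "g 0 = V" "g 1 = W"
    using g h(3,4) V W by (auto intro!: eq)
  ultimately show ?thesis
    unfolding path_component_of_def pathin_def by (intro exI[of _ g] conjI)
qed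

theorem mainTheorem1:
  assumes "CARD('m::finite) > CARD('n::finite)"
  shows "path_connected_space
    (Metric_space.mtopology (RIF :: (complex \<Rightarrow> complex^'n^'m) set) RIF_dist)"
proof -
  interpret Metric_space "RIF :: (complex \<Rightarrow> complex^'n^'m) set" RIF_dist
    by (rule Metric_space_RIF)
  obtain \<sigma> :: "'n \<Rightarrow> 'm" where \<sigma>: "inj \<sigma>"
    using assms card_le_inj[of "UNIV :: 'n set" "UNIV :: 'm set"] by auto
  have "card (range \<sigma>) < CARD('m)"
    using assms card_image[OF \<sigma>] by simp
  then obtain i where i: "i \<notin> range \<sigma>" by (metis UNIV_eq_I less_irrefl)
  have hom: "inner_homotopic W (\<lambda>_. coordinate_isometry \<sigma>)" if "W \<in> RIF"
    for W :: "complex \<Rightarrow> complex^'n^'m"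
    using RIF_inner_fraction[OF that] inner_fraction_homotopic[OF \<sigma> i] by metis
  have "inner_homotopic V W" if "V \<in> RIF" "W \<in> RIF" for V W :: "complex \<Rightarrow> complex^'n^'m"
    by (rule homotopic_with_trans[OF hom[OF that(1)] homotopic_with_symD[OF hom[OF that(2)]]])
  then show ?thesis
    unfolding path_connected_space_iff_path_component topspace_mtopology
    using inner_homotopic_path_component by blast
qed

end
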